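(* Consider $d,N\in\mathbb N$, $M\in2\mathbb N$, points $\boldsymbol x_j\in\mathbb T^d$ and weights $w_j\in\mathbb C$, $j=1,\dots,N$. For a trigonometric polynomial $f(\boldsymbol x)=\sum_{\boldsymbol k\in\mathcal I_{\boldsymbol M}}\hat f_{\boldsymbol k}\,\mathrm e^{2\pi\mathrm i\boldsymbol k\boldsymbol x}$ put $h^{\mathrm w}_{\boldsymbol k}:=\sum_{j=1}^N w_j f(\boldsymbol x_j)\,\mathrm e^{-2\pi\mathrm i\boldsymbol k\boldsymbol x_j}$, $\boldsymbol k\in\mathcal I_{\boldsymbol M}$. (a) The condition $$\sum_{j=1}^N w_j\,\mathrm e^{2\pi\mathrm i\boldsymbol k\boldsymbol x_j}=\delta_{\boldsymbol 0,\boldsymbol k},\qquad\boldsymbol k\in\mathcal I_{\boldsymbol M},$$ (equivalently, exactness of the quadrature rule $\int_{\mathbb T^d}f(\boldsymbol x)\,\mathrm d\boldsymbol x=\sum_{j=1}^Nw_jf(\boldsymbol x_j)$ for all trigonometric polynomials $f$ of maximum degree $\boldsymbol M$) is not equivalent to the property that $\hat f_{\boldsymbol k}=h^{\mathrm w}_{\boldsymbol k}$, $\boldsymbol k\in\mathcal I_{\boldsymbol M}$, for all trigonometric polynomials of maximum degree $\boldsymbol M$: the former does not in general imply the latter, i.e. there exist $d,N,M$, points and weights satisfying the former but not the latter. (b) If the augmented condition $$\sum_{j=1}^N w_j\,\mathrm e^{2\pi\mathrm i\boldsymbol k\boldsymbol x_j}=\delta_{\boldsymbol 0,\boldsymbol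 k},\qquad\boldsymbol k\in\mathcal I_{\boldsymbol{2M}},$$ holds, then $\hat f_{\boldsymbol k}=h^{\mathrm w}_{\boldsymbol k}$, $\boldsymbol k\in\mathcal I_{\boldsymbol M}$, for every trigonometric polynomial $f$ of maximum degree $\boldsymbol M$. Additionally, the augmented condition implies the matrix equation $\boldsymbol A^*\boldsymbol W\boldsymbol A=\boldsymbol I_{|\mathcal I_{\boldsymbol M}|}$, where $\boldsymbol A=\left(\mathrm e^{2\pi\mathrm i\boldsymbol k\boldsymbol x_j}\right)_{j=1,\,\boldsymbol k\in\mathcal I_{\boldsymbol M}}^{N}\in\mathbb C^{N\times|\mathcal I_{\boldsymbol M}|}$, $\boldsymbol W=\mathrm{diag}(w_j)_{j=1}^N$, and $\boldsymbol I_{|\mathcal I_{\boldsymbol M}|}$ is the identity matrix of size $|\mathcal I_{\boldsymbol M}|$.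
   Context: $\mathbb T^d\cong[-\tfrac12,\tfrac12)^d$ is the $d$-dimensional torus. For $M\in2\mathbb N$ write $\boldsymbol M=(M,\dots,M)^T$, $\mathcal I_{\boldsymbol M}:=\mathbb Z^d\cap[-\tfrac M2,\tfrac M2)^d$ and $\mathcal I_{\boldsymbol{2M}}:=\mathbb Z^d\cap[-M,M)^d$. For vectors, $\boldsymbol k\boldsymbol x:=k_1x_1+\dots+k_dx_d$. A trigonometric polynomial of (maximum) degree $\boldsymbol M$ is a function of the form $\sum_{\boldsymbol k\in\mathcal I_{\boldsymbol M}}\hat f_{\boldsymbol k}\mathrm e^{2\pi\mathrm i\boldsymbol k\boldsymbol x}$ with $\hat f_{\boldsymbol k}\in\mathbb C$. $\boldsymbol A^*$ is the conjugate transpose; $\delta_{\boldsymbol 0,\boldsymbol k}$ is the Kronecker delta. *)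

theory Defs
  imports
    "HOL-Analysis.Analysis"
    "Jordan_Normal_Form.Schur_Decomposition"
begin

text \<open>
  The dimension \<open>d\<close> is quantified inside the statement, so vectors are extensional functions on
  \<open>{..<d}\<close>, i.e. elements of a \<^const>\<open>PiE\<close>. Coordinates and nodes are numbered from 0.
\<close>

text \<open>The fundamental domain $[-1/2, 1/2)^d$ of the torus.\<close>

definition torus :: "nat \<Rightarrow> (nat \<Rightarrow> real) set" where
  "torus d = ({..<d} \<rightarrow>\<^sub>E {-1/2..<1/2})"

text \<open>The index set $\mathbb{Z}^d \cap [-M/2, M/2)^d$.\<close>

definition freqs :: "nat \<Rightarrow> nat \<Rightarrow> (nat \<Rightarrow> int) set" where
  "freqs d M = ({..<d} \<rightarrow>\<^sub>E {m. - (real M / 2) \<le> of_int m \<and> of_int m < real M / 2})"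

definition freq_dot :: "nat \<Rightarrow> (nat \<Rightarrow> int) \<Rightarrow> (nat \<Rightarrow> real) \<Rightarrow> real" where
  "freq_dot d k x = (\<Sum>i<d. of_int (k i) * x i)"

definition trig_poly ::
    "nat \<Rightarrow> nat \<Rightarrow> ((nat \<Rightarrow> int) \<Rightarrow> complex) \<Rightarrow> (nat \<Rightarrow> real) \<Rightarrow> complex" where
  "trig_poly d M c x =
     (\<Sum>k\<in>freqs d M. c k * exp (2 * of_real pi * \<i> * of_real (freq_dot d k x)))"

text \<open>The numbers $h^{\mathrm w}_k = \sum_j w_j f(x_j) e^{-2 \pi i k x_j}$.\<close>

definition weighted_adjoint ::
    "nat \<Rightarrow> nat \<Rightarrow> (nat \<Rightarrow> nat \<Rightarrow> real) \<Rightarrow> (nat \<Rightarrow> complex) \<Rightarrow>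
     ((nat \<Rightarrow> real) \<Rightarrow> complex) \<Rightarrow> (nat \<Rightarrow> int) \<Rightarrow> complex" where
  "weighted_adjoint d N x w f k =
     (\<Sum>j<N. w j * f (x j) * exp (- (2 * of_real pi * \<i> * of_real (freq_dot d k (x j)))))"

text \<open>
  \<open>moment_condition d N M x w\<close> is the condition on the index set for \<open>M\<close>; the augmented
  condition is \<open>moment_condition d N (2 * M) x w\<close>.
\<close>

definition moment_condition ::
    "nat \<Rightarrow> nat \<Rightarrow> nat \<Rightarrow> (nat \<Rightarrow> nat \<Rightarrow> real) \<Rightarrow> (nat \<Rightarrow> complex) \<Rightarrow> bool" where
  "moment_condition d N M x w \<longleftrightarrow>
     (\<forall>k\<in>freqs d M.
        (\<Sum>j<N. w j * exp (2 * of_real pi * \<i> * of_real (freq_dot d k (x j)))) =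
        (if \<forall>i<d. k i = 0 then 1 else 0))"

definition quadrature_exact ::
    "nat \<Rightarrow> nat \<Rightarrow> nat \<Rightarrow> (nat \<Rightarrow> nat \<Rightarrow> real) \<Rightarrow> (nat \<Rightarrow> complex) \<Rightarrow> bool" where
  "quadrature_exact d N M x w \<longleftrightarrow>
     (\<forall>c. (LINT y:torus d|Pi\<^sub>M {..<d} (\<lambda>_. lborel). trig_poly d M c y) =
          (\<Sum>j<N. w j * trig_poly d M c (x j)))"

definition exact_reconstruction ::
    "nat \<Rightarrow> nat \<Rightarrow> nat \<Rightarrow> (nat \<Rightarrow> nat \<Rightarrow> real) \<Rightarrow> (nat \<Rightarrow> complex) \<Rightarrow> bool" where
  "exact_reconstruction d N M x w \<longleftrightarrow>
     (\<forall>c. \<forall>k\<in>freqs d M. c k = weighted_adjoint d N x w (trig_poly d M c) k)"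

text \<open>
  The columns of the matrix are indexed by frequencies; \<open>\<kappa>\<close> enumerates them as
  \<open>\<kappa> 0, \<dots>, \<kappa> (card (freqs d M) - 1)\<close>.
\<close>

definition fourier_matrix ::
    "nat \<Rightarrow> nat \<Rightarrow> nat \<Rightarrow> (nat \<Rightarrow> nat \<Rightarrow> real) \<Rightarrow> (nat \<Rightarrow> nat \<Rightarrow> int) \<Rightarrow> complex mat" where
  "fourier_matrix d N M x \<kappa> =
     Matrix.mat N (card (freqs d M))
       (\<lambda>(j, l). exp (2 * of_real pi * \<i> * of_real (freq_dot d (\<kappa> l) (x j))))"

definition admissible :: "nat \<Rightarrow> nat \<Rightarrow> nat \<Rightarrow> (nat \<Rightarrow> nat \<Rightarrow> real) \<Rightarrow> bool" where
  "admissible d N M x \<longleftrightarrow> 0 < d \<and> 0 < N \<and> 0 < M \<and> even M \<and> (\<forall>j<N. x j \<in> torus d)"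

end

theory Submission
  imports Defs
begin

text \<open>
  Everything is read off the moments $m(k) = \sum_j w_j e^{2 \pi i k x_j}$ of the weighted nodes.

  The characters $e^{2 \pi i k x}$ have integral $\delta_{0,k}$ over the torus
  (\<open>set_integral_character\<close>). Integrating a trigonometric polynomial with coefficients $c_k$
  therefore gives $\sum_k c_k \delta_{0,k}$, whereas the quadrature rule gives
  $\sum_k c_k m(k)$. These agree for all $c$ exactly when $m(k) = \delta_{0,k}$ on the index set.

  Multiplying the polynomial by $e^{-2 \pi i k x}$ shifts its frequencies by $-k$, so that
  $h^{\mathrm w}_k = \sum_l c_l \, m(l - k)$ (\<open>weighted_adjoint_trig_poly\<close>), and the entries of
  $A^* W A$ are the same numbers $m(l - k)$ (\<open>fourier_gram_index\<close>). Reconstruction thus depends on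
  moments at \<^emph>\<open>differences\<close> of frequencies. Differences of elements of the index set for \<open>M\<close> lie in
  the one for \<open>2 * M\<close>, hence the augmented condition suffices for both claims.
  They need not lie in the index set for \<open>M\<close>: already for $d = 1$ and $M = 2$ the index set is
  $\{-1, 0\}$ and the difference $1 = 0 - (-1)$ is missing. With complex weights the moment at $1$
  is not determined by the one at $-1$; two nodes leave enough freedom to satisfy the condition at
  $-1$ and $0$ and violate it at $1$ (\<open>moment_condition_not_sufficient\<close>).
\<close>

section \<open>Characters and moments\<close>

definition character :: "nat \<Rightarrow> (nat \<Rightarrow> int) \<Rightarrow> (nat \<Rightarrow> real) \<Rightarrow> complex" where
  "character d k x = exp (2 * of_real pi * \<i> * of_real (freq_dot d k x))"

definition moment ::
    "nat \<Rightarrow> nat \<Rightarrow> (nat \<Rightarrow> nat \<Rightarrow> real) \<Rightarrow> (nat \<Rightarrow> complex) \<Rightarrow> (nat \<Rightarrow> int) \<Rightarrow> complex" where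
  "moment d N x w k = (\<Sum>j<N. w j * character d k (x j))"

text \<open>
  The restriction keeps the difference extensional, as membership in \<^const>\<open>freqs\<close> demands.
\<close>

definition freq_diff :: "nat \<Rightarrow> (nat \<Rightarrow> int) \<Rightarrow> (nat \<Rightarrow> int) \<Rightarrow> (nat \<Rightarrow> int)" where
  "freq_diff d l k = restrict (\<lambda>i. l i - k i) {..<d}"

lemma trig_poly_eq_sum_character:
  "trig_poly d M c x = (\<Sum>k\<in>freqs d M. c k * character d k x)"
  by (simp add: trig_poly_def character_def)

lemma moment_condition_iff_moment:
  "moment_condition d N M x w \<longleftrightarrow>
     (\<forall>k\<in>freqs d M. moment d N x w k = (if \<forall>i<d. k i = 0 then 1 else 0))"
  by (simp add: moment_condition_def moment_def character_def)

lemma finite_freqs [simp]: "finite (freqs d M)"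
proof -
  have "{m. - (real M / 2) \<le> real_of_int m \<and> real_of_int m < real M / 2} \<subseteq> {- int M..int M}"
    by auto
  then have "finite {m. - (real M / 2) \<le> real_of_int m \<and> real_of_int m < real M / 2}"
    by (rule finite_subset) simp
  then show ?thesis
    unfolding freqs_def by (intro finite_PiE) auto
qed

lemma freq_diff_in_freqs:
  assumes "k \<in> freqs d M" "l \<in> freqs d M"
  shows "freq_diff d l k \<in> freqs d (2 * M)"
proof -
  have "- real M \<le> real_of_int (l i - k i) \<and> real_of_int (l i - k i) < real M" if "i < d" for i
  proof -
    have "- (real M / 2) \<le> real_of_int (k i) \<and> real_of_int (k i) < real M / 2"
         "- (real M / 2) \<le> real_of_int (l i) \<and> real_of_int (l i) < real M / 2"
      using assms that by (auto simp: freqs_def PiE_iff)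
    then show ?thesis by simp
  qed
  then show ?thesis
    by (auto simp: freqs_def freq_diff_def)
qed

lemma freq_diff_eq_zero_iff:
  assumes "k \<in> freqs d M" "l \<in> freqs d M"
  shows "(\<forall>i<d. freq_diff d l k i = 0) \<longleftrightarrow> l = k"
  using assms by (auto simp: freqs_def freq_diff_def intro: PiE_ext)

lemma character_freq_diff:
  "character d l x * exp (- (2 * of_real pi * \<i> * of_real (freq_dot d k x)))
     = character d (freq_diff d l k) x"
proof -
  have "freq_dot d (freq_diff d l k) x = freq_dot d l x - freq_dot d k x"
    by (simp add: freq_dot_def freq_diff_def sum_subtractf [symmetric] algebra_simps)
  then show ?thesis
    by (simp add: character_def right_diff_distrib exp_diff exp_minus divide_inverse)
qed

lemma cnj_character:
  "cnj (character d k x) = exp (- (2 * of_real pi * \<i> * of_real (freq_dot d k x)))"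
  by (simp add: character_def exp_cnj)

lemma character_eq_prod:
  "character d k x = (\<Prod>i<d. exp (2 * of_real pi * \<i> * of_real (of_int (k i) * x i)))"
  by (simp add: character_def freq_dot_def sum_distrib_left flip: exp_sum)

section \<open>Exact quadrature\<close>

lemma set_integrable_exp_unit_interval:
  "set_integrable lborel {-1/2..<1/2}
     (\<lambda>y. exp (2 * of_real pi * \<i> * of_real (of_int m * y)) :: complex)"
  by (rule set_integrable_subset [OF borel_integrable_atLeastAtMost' [of "-1/2" "1/2"]])
     (auto intro!: continuous_intros)

lemma set_integral_exp_unit_interval:
  "(LINT y:{-1/2..<1/2}|lborel. exp (2 * of_real pi * \<i> * of_real (of_int m * y)) :: complex)
     = (if m = 0 then 1 else 0)"
proof -
  define f :: "real \<Rightarrow> complex" where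
    "f = (\<lambda>y. exp (2 * of_real pi * \<i> * of_real (of_int m * y)))"
  define F :: "real \<Rightarrow> complex" where
    "F = (\<lambda>y. if m = 0 then of_real y else f y / (2 * of_real pi * \<i> * of_int m))"
  have deriv: "(F has_vector_derivative f y) (at y within {-1/2..1/2})" for y
  proof (cases "m = 0")
    case True
    then show ?thesis
      using has_vector_derivative_real_field [OF DERIV_ident] by (simp add: F_def f_def)
  next
    case False
    have "((\<lambda>z. exp (2 * of_real pi * \<i> * of_int m * z) / (2 * of_real pi * \<i> * of_int m))
             has_field_derivative exp (2 * of_real pi * \<i> * of_int m * of_real y)) (at (of_real y))"
      using False by (auto intro!: derivative_eq_intros)
    from has_vector_derivative_real_field [OF this] show ?thesis
      using False by (simp add: F_def f_def mult.assoc)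
  qed
  have "(LINT y:{-1/2..<1/2}|lborel. f y) = (LINT y:{-1/2..1/2}|lborel. f y)"
    unfolding set_lebesgue_integral_def
    by (rule integral_cong_AE)
       (auto simp: f_def indicator_def intro!: eventually_mono [OF AE_lborel_singleton [of "1/2"]])
  also have "\<dots> = F (1/2) - F (-1/2)"
    unfolding set_lebesgue_integral_def
    by (rule integral_FTC_atLeastAtMost [OF _ deriv])
       (auto simp: f_def intro!: continuous_intros)
  also have "\<dots> = (if m = 0 then 1 else 0)"
  proof (cases "m = 0")
    case False
    \<comment> \<open>The interval is a whole number of periods of the character long.\<close>
    have "f (1/2) = f (-1/2) * exp (2 * of_real pi * \<i> * of_int m)"
      unfolding f_def exp_add [symmetric]
      by (rule arg_cong [where f = exp]) (simp add: field_simps)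
    also have "exp (2 * of_real pi * \<i> * of_int m) = (1 :: complex)"
      by (simp add: exp_eq_1)
    finally show ?thesis using False by (simp add: F_def)
  qed (simp add: F_def)
  finally show ?thesis by (simp add: f_def)
qed

text \<open>
  On the product space, the indicator of the cube and the character both factor over the
  coordinates, so that Fubini reduces integration to one dimension.
\<close>

lemma indicator_torus_scaleR_character:
  assumes "y \<in> space (Pi\<^sub>M {..<d} (\<lambda>_. lborel))"
  shows "indicator (torus d) y *\<^sub>R character d k y
     = (\<Prod>i<d. indicator {-1/2..<1/2} (y i) *\<^sub>R
          exp (2 * of_real pi * \<i> * of_real (of_int (k i) * y i)))"
proof (cases "y \<in> torus d")
  case True
  then show ?thesis
    by (auto simp: torus_def PiE_iff character_eq_prod intro!: prod.cong)
next
  case False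
  then obtain i where "i < d" "y i \<notin> {-1/2..<1/2}"
    using assms by (auto simp: torus_def space_PiM PiE_iff)
  then have "(\<Prod>i<d. indicator {-1/2..<1/2} (y i) *\<^sub>R
          exp (2 * of_real pi * \<i> * of_real (of_int (k i) * y i)) :: complex) = 0"
    by (intro prod_zero) (auto simp: indicator_def intro!: bexI [of _ i])
  then show ?thesis using False by simp
qed

lemma set_integrable_character:
  "set_integrable (Pi\<^sub>M {..<d} (\<lambda>_. lborel)) (torus d) (character d k)"
proof -
  interpret product_sigma_finite "\<lambda>_ :: nat. lborel :: real measure"
    by standard
  show ?thesis
    unfolding set_integrable_def
    by (subst Bochner_Integration.integrable_cong [OF refl indicator_torus_scaleR_character])
       (assumption, intro product_integrable_prod finite_lessThan
          set_integrable_exp_unit_interval [unfolded set_integrable_def])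
qed

lemma set_integral_character:
  "(LINT y:torus d|Pi\<^sub>M {..<d} (\<lambda>_. lborel). character d k y)
     = (if \<forall>i<d. k i = 0 then 1 else 0)"
proof -
  interpret product_sigma_finite "\<lambda>_ :: nat. lborel :: real measure"
    by standard
  have "(LINT y:torus d|Pi\<^sub>M {..<d} (\<lambda>_. lborel). character d k y)
      = (\<integral>y. (\<Prod>i<d. indicator {-1/2..<1/2} (y i) *\<^sub>R
          exp (2 * of_real pi * \<i> * of_real (of_int (k i) * y i))) \<partial>Pi\<^sub>M {..<d} (\<lambda>_. lborel))"
    unfolding set_lebesgue_integral_def
    by (intro Bochner_Integration.integral_cong refl indicator_torus_scaleR_character)
  also have "\<dots> = (\<Prod>i<d. LINT y:{-1/2..<1/2}|lborel.
          exp (2 * of_real pi * \<i> * of_real (of_int (k i) * y)))"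
    unfolding set_lebesgue_integral_def
    by (intro product_integral_prod finite_lessThan
          set_integrable_exp_unit_interval [unfolded set_integrable_def])
  also have "\<dots> = (\<Prod>i<d. if k i = 0 then 1 else 0)"
    by (simp only: set_integral_exp_unit_interval)
  also have "\<dots> = (if \<forall>i<d. k i = 0 then 1 else 0)"
    by (auto intro: prod_zero)
  finally show ?thesis .
qed

lemma set_integral_trig_poly:
  "(LINT y:torus d|Pi\<^sub>M {..<d} (\<lambda>_. lborel). trig_poly d M c y)
     = (\<Sum>k\<in>freqs d M. c k * (if \<forall>i<d. k i = 0 then 1 else 0))"
proof -
  have "(LINT y:torus d|Pi\<^sub>M {..<d} (\<lambda>_. lborel). trig_poly d M c y)
      = (\<integral>y. (\<Sum>k\<in>freqs d M. c k * (indicator (torus d) y *\<^sub>R character d k y))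
            \<partial>Pi\<^sub>M {..<d} (\<lambda>_. lborel))"
    unfolding set_lebesgue_integral_def
    by (simp add: trig_poly_eq_sum_character scaleR_sum_right)
  also have "\<dots> = (\<Sum>k\<in>freqs d M. c k *
      (LINT y:torus d|Pi\<^sub>M {..<d} (\<lambda>_. lborel). character d k y))"
    using set_integrable_character
    by (subst Bochner_Integration.integral_sum)
       (auto simp: set_lebesgue_integral_def set_integrable_def simp del: mult_scaleR_right)
  finally show ?thesis
    by (simp only: set_integral_character)
qed

lemma quadrature_trig_poly:
  "(\<Sum>j<N. w j * trig_poly d M c (x j)) = (\<Sum>k\<in>freqs d M. c k * moment d N x w k)"
  unfolding trig_poly_eq_sum_character moment_def sum_distrib_left
  by (subst sum.swap) (simp add: mult_ac)

lemma moment_condition_iff_quadrature_exact: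
  "moment_condition d N M x w \<longleftrightarrow> quadrature_exact d N M x w"
proof
  assume "moment_condition d N M x w"
  then show "quadrature_exact d N M x w"
    unfolding quadrature_exact_def moment_condition_iff_moment set_integral_trig_poly
      quadrature_trig_poly
    by (auto intro!: sum.cong)
next
  assume exact: "quadrature_exact d N M x w"
  show "moment_condition d N M x w"
    unfolding moment_condition_iff_moment
  proof
    fix k assume k: "k \<in> freqs d M"
    define c :: "(nat \<Rightarrow> int) \<Rightarrow> complex" where "c = (\<lambda>l. if l = k then 1 else 0)"
    have select: "(\<Sum>l\<in>freqs d M. c l * g l) = g k" for g
      using k by (simp add: c_def if_distrib [of "\<lambda>z. z * _"] sum.delta cong: if_cong)
    have "(\<Sum>l\<in>freqs d M. c l * (if \<forall>i<d. l i = 0 then 1 else 0))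
        = (\<Sum>l\<in>freqs d M. c l * moment d N x w l)"
      using exact unfolding quadrature_exact_def set_integral_trig_poly quadrature_trig_poly
      by blast
    then show "moment d N x w k = (if \<forall>i<d. k i = 0 then 1 else 0)"
      unfolding select by simp
  qed
qed

section \<open>Reconstruction\<close>

lemma weighted_adjoint_trig_poly:
  "weighted_adjoint d N x w (trig_poly d M c) k
     = (\<Sum>l\<in>freqs d M. c l * moment d N x w (freq_diff d l k))"
  unfolding weighted_adjoint_def trig_poly_eq_sum_character moment_def sum_distrib_left
    sum_distrib_right
  by (subst sum.swap) (simp add: mult_ac flip: character_freq_diff)

lemma augmented_moment_at_difference:
  assumes "moment_condition d N (2 * M) x w" "k \<in> freqs d M" "l \<in> freqs d M"
  shows "moment d N x w (freq_diff d l k) = (if l = k then 1 else 0)"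
  using assms freq_diff_in_freqs freq_diff_eq_zero_iff [OF assms(2,3)]
  by (auto simp: moment_condition_iff_moment)

lemma augmented_imp_exact_reconstruction:
  assumes "moment_condition d N (2 * M) x w"
  shows "exact_reconstruction d N M x w"
  unfolding exact_reconstruction_def weighted_adjoint_trig_poly
proof (intro allI ballI)
  fix c :: "(nat \<Rightarrow> int) \<Rightarrow> complex" and k
  assume k: "k \<in> freqs d M"
  have "(\<Sum>l\<in>freqs d M. c l * moment d N x w (freq_diff d l k))
      = (\<Sum>l\<in>freqs d M. if l = k then c l else 0)"
    by (intro sum.cong) (auto simp: augmented_moment_at_difference [OF assms k])
  also have "\<dots> = c k"
    using k by simp
  finally show "c k = (\<Sum>l\<in>freqs d M. c l * moment d N x w (freq_diff d l k))" ..
qed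

lemma fourier_gram_index:
  assumes "a < card (freqs d M)" "b < card (freqs d M)"
  shows "(mat_adjoint (fourier_matrix d N M x \<kappa>) * mat_diag N w * fourier_matrix d N M x \<kappa>) $$ (a, b)
     = moment d N x w (freq_diff d (\<kappa> b) (\<kappa> a))"
proof -
  let ?A = "fourier_matrix d N M x \<kappa>" and ?n = "card (freqs d M)"
  have A: "?A \<in> carrier_mat N ?n"
    by (simp add: fourier_matrix_def)
  have A_index: "?A $$ (j, l) = character d (\<kappa> l) (x j)" if "j < N" "l < ?n" for j l
    using that by (simp add: fourier_matrix_def character_def)
  have adj: "mat_adjoint ?A \<in> carrier_mat ?n N"
    using A by (auto simp: mat_adjoint_def)
  have adj_index: "mat_adjoint ?A $$ (l, j) = cnj (character d (\<kappa> l) (x j))"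
    if "j < N" "l < ?n" for j l
    using that A by (simp add: mat_adjoint_def mat_of_rows_index A_index conjugate_complex_def)
  have "(mat_adjoint ?A * mat_diag N w * ?A) $$ (a, b)
      = (\<Sum>j<N. cnj (character d (\<kappa> a) (x j)) * w j * character d (\<kappa> b) (x j))"
    using assms A adj
    by (auto simp: mat_diag_mult_right [OF adj] scalar_prod_def A_index adj_index
          atLeast0LessThan intro!: sum.cong)
  also have "\<dots> = moment d N x w (freq_diff d (\<kappa> b) (\<kappa> a))"
    unfolding moment_def cnj_character
    by (intro sum.cong refl) (simp add: mult_ac flip: character_freq_diff)
  finally show ?thesis .
qed

lemma augmented_imp_fourier_gram_eq_one:
  assumes aug: "moment_condition d N (2 * M) x w"
    and \<kappa>: "bij_betw \<kappa> {..<card (freqs d M)} (freqs d M)"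
  shows "mat_adjoint (fourier_matrix d N M x \<kappa>) * mat_diag N w * fourier_matrix d N M x \<kappa>
     = 1\<^sub>m (card (freqs d M))"
proof (rule eq_matI)
  fix a b
  assume "a < dim_row (1\<^sub>m (card (freqs d M)) :: complex mat)"
    and "b < dim_col (1\<^sub>m (card (freqs d M)) :: complex mat)"
  then have ab: "a < card (freqs d M)" "b < card (freqs d M)"
    by simp_all
  then have "\<kappa> a \<in> freqs d M" "\<kappa> b \<in> freqs d M" "\<kappa> b = \<kappa> a \<longleftrightarrow> b = a"
    using \<kappa> by (auto simp: bij_betw_def inj_on_eq_iff)
  then show "(mat_adjoint (fourier_matrix d N M x \<kappa>) * mat_diag N w * fourier_matrix d N M x \<kappa>)
      $$ (a, b) = 1\<^sub>m (card (freqs d M)) $$ (a, b)"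
    using ab by (auto simp: fourier_gram_index augmented_moment_at_difference [OF aug])
qed (simp_all add: fourier_matrix_def mat_adjoint_def)

section \<open>The unaugmented condition does not suffice\<close>

text \<open>
  The nodes $0$ and $1/4$ have the values $1$ and $i$ under the character of frequency $1$. The
  weights solve the two linear equations $w_0 + w_1 = 1$ and $w_0 - i w_1 = 0$, which say that the
  moments at $0$ and $-1$ are right; the moment at $1$ is then $w_0 + i w_1 = 2 i w_1 \<noteq> 0$.
  It shows up as the coefficient at $-1$ that is recovered from the constant polynomial $1$.
\<close>

lemma moment_condition_not_sufficient:
  "\<exists>d N M x w. admissible d N M x \<and> moment_condition d N M x w
     \<and> \<not> exact_reconstruction d N M x w"
proof -
  define x :: "nat \<Rightarrow> nat \<Rightarrow> real" where
    "x = (\<lambda>j. restrict (\<lambda>_. if j = 0 then 0 else 1/4) {..<1})"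
  define w :: "nat \<Rightarrow> complex" where
    "w = (\<lambda>j. if j = 0 then \<i> / (1 + \<i>) else 1 / (1 + \<i>))"
  define freq :: "int \<Rightarrow> nat \<Rightarrow> int" where "freq = (\<lambda>m. restrict (\<lambda>_. m) {..<1})"
  have nonzero: "1 + \<i> \<noteq> 0"
    by (simp add: complex_eq_iff)
  have admissible: "admissible 1 2 2 x"
    by (auto simp: admissible_def torus_def x_def)
  have freqs: "freqs 1 2 = {freq (-1), freq 0}"
  proof -
    have "{m :: int. - (real 2 / 2) \<le> of_int m \<and> of_int m < real 2 / 2} = {-1, 0}"
      by auto
    moreover have "{..<1} = {0 :: nat}"
      by auto
    ultimately show ?thesis
      unfolding freqs_def freq_def by (simp only: PiE_over_singleton_iff) auto
  qed
  have quarter: "exp (2 * of_real pi * \<i> * of_real (1/4)) = \<i>"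
    using cis_conv_exp [of "pi / 2"] by (simp add: algebra_simps)
  have moment: "moment 1 2 x w k = (\<i> + \<i> powi (k 0)) / (1 + \<i>)" for k
  proof -
    have "character 1 k (x 1) = exp (of_int (k 0) * (2 * of_real pi * \<i> * of_real (1/4)))"
      by (simp add: character_def freq_dot_def x_def mult_ac)
    also have "\<dots> = exp (2 * of_real pi * \<i> * of_real (1/4)) powi (k 0)"
      by (rule exp_power_int [symmetric])
    finally have "character 1 k (x 1) = \<i> powi (k 0)"
      unfolding quarter .
    moreover have "character 1 k (x 0) = 1"
      by (simp add: character_def freq_dot_def x_def)
    ultimately show ?thesis
      by (simp add: moment_def w_def lessThan_Suc numeral_2_eq_2 add_divide_distrib)
  qed
  have condition: "moment_condition 1 2 2 x w"
    unfolding moment_condition_iff_moment freqs moment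
    using nonzero by (simp add: freq_def add.commute)
  have "\<not> exact_reconstruction 1 2 2 x w"
  proof
    assume exact: "exact_reconstruction 1 2 2 x w"
    define c :: "(nat \<Rightarrow> int) \<Rightarrow> complex" where "c = (\<lambda>k. if k = freq 0 then 1 else 0)"
    have distinct: "freq (-1) \<noteq> freq 0"
      by (auto simp: freq_def fun_eq_iff)
    have "c (freq (-1)) = weighted_adjoint 1 2 x w (trig_poly 1 2 c) (freq (-1))"
      using exact unfolding exact_reconstruction_def freqs by blast
    also have "\<dots> = moment 1 2 x w (freq_diff 1 (freq 0) (freq (-1)))"
      unfolding weighted_adjoint_trig_poly freqs using distinct by (simp add: c_def)
    also have "\<dots> = 2 * \<i> / (1 + \<i>)"
      unfolding moment by (simp add: freq_diff_def freq_def)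
    finally show False
      using distinct nonzero by (simp add: c_def)
  qed
  with admissible condition show ?thesis by blast
qed

theorem corollary3p4:
  shows "(\<forall>d N M x w. admissible d N M x \<longrightarrow>
            (moment_condition d N M x w \<longleftrightarrow> quadrature_exact d N M x w))
       \<and> (\<exists>d N M x w. admissible d N M x \<and> moment_condition d N M x w
            \<and> \<not> exact_reconstruction d N M x w)
       \<and> (\<forall>d N M x w. admissible d N M x \<longrightarrow> moment_condition d N (2 * M) x w \<longrightarrow>
            exact_reconstruction d N M x w
            \<and> (\<forall>\<kappa>. bij_betw \<kappa> {..<card (freqs d M)} (freqs d M) \<longrightarrow>
                 mat_adjoint (fourier_matrix d N M x \<kappa>) * mat_diag N w * fourier_matrix d N M x \<kappa>
                   = 1\<^sub>m (card (freqs d M))))"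
  using moment_condition_iff_quadrature_exact moment_condition_not_sufficient
    augmented_imp_exact_reconstruction augmented_imp_fourier_gram_eq_one
  by blast

end
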